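(* For every integer $k\ge 0$, the number $g_{k+\frac12}=\sum_{\mu} g_{k+\frac12}(\mu)$ (sum over all integer partitions $\mu$) is the number of symmetric partitions of the set $[-k,k]=\{-k,\dots,-1,0,1,\dots,k\}$.
   Context: Integer partitions are identified with their Young diagrams and ordered by containment; $\emptyset$ is the only partition of $0$. A simplified vacillating tableau of shape $\mu$ and length $2k+1$ is a sequence of $2k+2$ integer partitions $(\mu^{(0)}=\emptyset,\mu^{(1/2)},\mu^{(1)},\dots,\mu^{(k)},\mu^{(k+1/2)}=\mu)$ such that (a) for each integer $j=0,\dots,k$: $\mu^{(j)}\supseteq\mu^{(j+1/2)}$ and $|\mu^{(j)}/\mu^{(j+1/2)}|\in\{0,1\}$; (b) for each integer $j=0,\dots,k-1$: $\mu^{(j+1/2)}\subseteq\mu^{(j+1)}$ and $|\mu^{(j+1)}/\mu^{(j+1/2)}|\in\{0,1\}$. $g_{k+\frac12}(\mu)$ is the number of simplified vacillating tableaux of shape $\mu$ and length $2k+1$. A set partition of $[-k,k]$ is symmetric if $-B$ is a block whenever $B$ is a block, where $-B=\{-b: b\in B\}$. *)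

theory Defs
  imports "HOL-Analysis.Infinite_Sum" "HOL-Library.Disjoint_Sets"
begin

text \<open>An integer partition is the weakly decreasing list of its positive parts.\<close>

definition integer_partition :: "nat list \<Rightarrow> bool" where
  "integer_partition \<mu> \<longleftrightarrow> sorted_wrt (\<ge>) \<mu> \<and> 0 \<notin> set \<mu>"

definition young_diagram :: "nat list \<Rightarrow> (nat \<times> nat) set" where
  "young_diagram \<mu> = {(i, j). i < length \<mu> \<and> j < \<mu> ! i}"

text \<open>\<open>removes_at_most_one \<kappa> \<mu>\<close>: \<open>\<kappa>\<close> contains \<open>\<mu>\<close> and the skew shape \<open>\<kappa>/\<mu>\<close> has at most one cell.\<close>

definition removes_at_most_one :: "nat list \<Rightarrow> nat list \<Rightarrow> bool" where
  "removes_at_most_one \<kappa> \<mu> \<longleftrightarrow>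
     young_diagram \<mu> \<subseteq> young_diagram \<kappa> \<and>
     card (young_diagram \<kappa> - young_diagram \<mu>) \<in> {0, 1}"

text \<open>The half-integer indices are doubled: for integral \<open>j\<close>, the partition \<open>\<mu>\<close> with
  index \<open>j\<close> is \<open>t ! (2 * j)\<close>, and the one with index \<open>j + 1/2\<close> is \<open>t ! (2 * j + 1)\<close>.\<close>

definition simplified_vacillating_tableaux :: "nat \<Rightarrow> nat list \<Rightarrow> nat list list set" where
  "simplified_vacillating_tableaux k \<mu> =
     {t. length t = 2 * k + 2 \<and>
         (\<forall>\<nu>\<in>set t. integer_partition \<nu>) \<and>
         t ! 0 = [] \<and> t ! (2 * k + 1) = \<mu> \<and>
         (\<forall>j\<le>k. removes_at_most_one (t ! (2 * j)) (t ! (2 * j + 1))) \<and>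
         (\<forall>j<k. removes_at_most_one (t ! (2 * j + 2)) (t ! (2 * j + 1)))}"

definition g_half :: "nat \<Rightarrow> nat list \<Rightarrow> nat" where
  "g_half k \<mu> = card (simplified_vacillating_tableaux k \<mu>)"

definition symmetric_partitions :: "nat \<Rightarrow> int set set set" where
  "symmetric_partitions k =
     {P. partition_on {- int k..int k} P \<and> (\<forall>B\<in>P. uminus ` B \<in> P)}"

text \<open>The sets counted above are finite, so \<^const>\<open>card\<close> never takes its default value.\<close>

lemma finite_symmetric_partitions: "finite (symmetric_partitions k)"
  by (rule finite_subset[of _ "Pow (Pow {- int k..int k})"])
     (auto simp: symmetric_partitions_def partition_on_def)

lemma finite_young_diagram: "finite (young_diagram \<mu>)"
proof -
  have "young_diagram \<mu> = (SIGMA i:{..<length \<mu>}. {..<\<mu> ! i})"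
    by (auto simp: young_diagram_def)
  then show ?thesis by simp
qed

lemma length_parts_le_card_young_diagram:
  assumes "integer_partition \<mu>"
  shows "length \<mu> \<le> card (young_diagram \<mu>)" and "x \<in> set \<mu> \<Longrightarrow> x \<le> card (young_diagram \<mu>)"
proof -
  have "(\<lambda>i. (i, 0)) ` {..<length \<mu>} \<subseteq> young_diagram \<mu>"
    using assms by (auto simp: young_diagram_def integer_partition_def in_set_conv_nth)
  from card_mono[OF finite_young_diagram this] show "length \<mu> \<le> card (young_diagram \<mu>)"
    by (simp add: card_image inj_on_def)
next
  assume "x \<in> set \<mu>"
  then obtain i where i: "i < length \<mu>" "\<mu> ! i = x" by (auto simp: in_set_conv_nth)
  then have "Pair i ` {..<x} \<subseteq> young_diagram \<mu>"
    by (auto simp: young_diagram_def)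
  from card_mono[OF finite_young_diagram this] show "x \<le> card (young_diagram \<mu>)"
    by (simp add: card_image inj_on_def)
qed

lemma card_young_diagram_tableau_le:
  assumes t: "t \<in> simplified_vacillating_tableaux k \<mu>" and "i < 2 * k + 2"
  shows "card (young_diagram (t ! i)) \<le> i"
  using \<open>i < 2 * k + 2\<close>
proof (induction i)
  case 0
  then show ?case using t by (simp add: simplified_vacillating_tableaux_def young_diagram_def)
next
  case (Suc i)
  consider j where "i = 2 * j" "j \<le> k" | j where "i = 2 * j + 1" "j < k"
    using Suc.prems by (cases "even i") (auto elim!: evenE oddE)
  then show ?case
  proof cases
    case 1
    then have "young_diagram (t ! Suc i) \<subseteq> young_diagram (t ! i)"
      using t by (auto simp: simplified_vacillating_tableaux_def removes_at_most_one_def)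
    from card_mono[OF finite_young_diagram this] show ?thesis
      using Suc by simp
  next
    case 2
    then have r: "removes_at_most_one (t ! Suc i) (t ! i)"
      using t by (auto simp: simplified_vacillating_tableaux_def)
    then have "card (young_diagram (t ! Suc i)) - card (young_diagram (t ! i)) \<le> 1"
      by (auto simp: removes_at_most_one_def card_Diff_subset finite_young_diagram)
    then show ?thesis using Suc by simp
  qed
qed

lemma finite_simplified_vacillating_tableaux: "finite (simplified_vacillating_tableaux k \<mu>)"
proof -
  let ?n = "2 * k + 2"
  let ?L = "{xs. set xs \<subseteq> {..?n} \<and> length xs \<le> ?n}"
  have "simplified_vacillating_tableaux k \<mu> \<subseteq> {t. set t \<subseteq> ?L \<and> length t = ?n}"
  proof
    fix t assume t: "t \<in> simplified_vacillating_tableaux k \<mu>"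
    then have len: "length t = ?n" and ip: "\<forall>\<nu>\<in>set t. integer_partition \<nu>"
      by (auto simp: simplified_vacillating_tableaux_def)
    have "\<nu> \<in> ?L" if "\<nu> \<in> set t" for \<nu>
    proof -
      from that len obtain i where "i < ?n" "\<nu> = t ! i" by (auto simp: in_set_conv_nth)
      then have "card (young_diagram \<nu>) \<le> ?n"
        using card_young_diagram_tableau_le[OF t, of i] by simp
      then show ?thesis
        using length_parts_le_card_young_diagram[of \<nu>] ip that by (force intro: order_trans)
    qed
    then show "t \<in> {t. set t \<subseteq> ?L \<and> length t = ?n}" using len by blast
  qed
  moreover have "finite {t. set t \<subseteq> ?L \<and> length t = ?n}"
    by (intro finite_lists_length_eq finite_lists_length_le) simp
  ultimately show ?thesis by (rule finite_subset)
qed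

end

theory Submission
  imports Defs
begin

text \<open>
  Lengthening a tableau by one removal and one addition obeys the same recursion as enlarging a
  symmetric partition by two opposite elements. Let \<open>D\<close> and \<open>U\<close> be the operators on
  formal sums of partitions that remove, respectively add, one cell in all possible ways, and let \<open>s\<close> be the functional taking the sum of the
  coefficients. A tableau alternates the steps \<open>1 + D\<close> and \<open>1 + U\<close>, so that the tableaux of length
  \<open>2k + 1\<close> are counted by \<open>s (1 + D) [(1 + U) (1 + D)]^k\<close> applied to the empty partition. Put
  \<open>v t = s (1 + D)^t\<close>, the number of chains of \<open>t\<close> successive steps that each remove at most one
  cell. Young's lattice satisfies \<open>D U - U D = 1\<close>, and every partition has one more addable cell
  than removable cells, that is \<open>s U = s (D + 1)\<close>; these two facts give

  \<open>v t (1 + U) (1 + D) = t v t + v (t + 1) + v (t + 2)\<close>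

  (\<open>sum_down_up_removal_chains\<close>).

  On the other side, a symmetric partition of \<open>[-(k+1), k+1]\<close> arises from one of \<open>[-k, k]\<close>, with
  \<open>t\<close> blocks say, by inserting \<open>\<plusminus>(k + 1)\<close>: the element \<open>k + 1\<close> joins one of the \<open>t\<close> blocks and
  \<open>-(k + 1)\<close> joins the negative of that block (\<open>t\<close> ways, still \<open>t\<close> blocks); or the two elements
  form a block of their own (\<open>t + 1\<close> blocks); or each of them is a singleton (\<open>t + 2\<close> blocks). This
  is \<open>sum_symmetric_partitions_Suc\<close>, with the same coefficients \<open>t, 1, 1\<close>.

  By induction on \<open>k\<close>, the tableaux of length \<open>2k + 1\<close> that start at any partition \<open>\<kappa>\<close> are
  counted by the sum of \<open>v (card P)\<close> at \<open>\<kappa>\<close> over the symmetric partitions \<open>P\<close> of \<open>[-k, k]\<close>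
  (\<open>card_tableaux_from\<close>). The arbitrary starting point is what makes the induction work. At the empty
  partition nothing can be removed, every \<open>v t\<close> equals 1, and the sum becomes the number of
  symmetric partitions.
\<close>

section \<open>Young diagrams as finite down-sets\<close>

text \<open>As sets of cells, diagrams have literal unions and intersections, which are the joins and
  meets of Young's lattice.\<close>
definition diagram :: "(nat \<times> nat) set \<Rightarrow> bool" where
  "diagram S \<longleftrightarrow> finite S \<and> (\<forall>i j i' j'. (i, j) \<in> S \<longrightarrow> i' \<le> i \<longrightarrow> j' \<le> j \<longrightarrow> (i', j') \<in> S)"

lemma diagramD: "diagram S \<Longrightarrow> (i, j) \<in> S \<Longrightarrow> i' \<le> i \<Longrightarrow> j' \<le> j \<Longrightarrow> (i', j') \<in> S"
  unfolding diagram_def by blast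

lemma diagram_finite: "diagram S \<Longrightarrow> finite S"
  by (simp add: diagram_def)

lemma diagram_Un:
  assumes "diagram S" and "diagram T"
  shows "diagram (S \<union> T)"
  unfolding diagram_def
proof (intro conjI allI impI)
  fix i j i' j' assume "(i, j) \<in> S \<union> T" "i' \<le> i" "j' \<le> j"
  then show "(i', j') \<in> S \<union> T"
    using diagramD[OF assms(1), of i j i' j'] diagramD[OF assms(2), of i j i' j'] by auto
qed (simp add: assms diagram_finite)

lemma diagram_Int:
  assumes "diagram S" and "diagram T"
  shows "diagram (S \<inter> T)"
  unfolding diagram_def
proof (intro conjI allI impI)
  fix i j i' j' assume "(i, j) \<in> S \<inter> T" "i' \<le> i" "j' \<le> j"
  then show "(i', j') \<in> S \<inter> T"
    using diagramD[OF assms(1), of i j i' j'] diagramD[OF assms(2), of i j i' j'] by auto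
qed (simp add: assms diagram_finite)

definition row :: "(nat \<times> nat) set \<Rightarrow> nat \<Rightarrow> nat" where
  "row S i = card {j. (i, j) \<in> S}"

lemma finite_downset_nat:
  assumes "finite N" and "\<And>m n. n \<in> N \<Longrightarrow> m \<le> n \<Longrightarrow> m \<in> N"
  shows "N = {..<card N}"
proof (cases "N = {}")
  case False
  have "N = {..Max N}"
    using assms False by (auto intro: Max_in)
  moreover have "card {..Max N} = Suc (Max N)" by simp
  ultimately show ?thesis by (metis lessThan_Suc_atMost)
qed simp

text \<open>A diagram is determined by its row lengths; its corners are then found by comparing the lengths
  of consecutive rows.\<close>
lemma mem_diagram_iff:
  assumes "diagram S"
  shows "(i, j) \<in> S \<longleftrightarrow> j < row S i"
proof -
  have "finite {j. (i, j) \<in> S}"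
    by (rule finite_subset[of _ "snd ` S"]) (force simp: assms diagram_finite)+
  from finite_downset_nat[OF this] show ?thesis
    using diagramD[OF assms] unfolding row_def by (metis (no_types, lifting) lessThan_iff mem_Collect_eq order_refl)
qed

lemma row_antimono: "diagram S \<Longrightarrow> i \<le> i' \<Longrightarrow> row S i' \<le> row S i"
  by (metis diagramD leI less_irrefl mem_diagram_iff order_refl)

lemma diagram_young_diagram:
  assumes "integer_partition \<mu>"
  shows "diagram (young_diagram \<mu>)"
proof -
  have "\<mu> ! i \<le> \<mu> ! i'" if "i' \<le> i" "i < length \<mu>" for i i'
    using assms that by (cases "i' = i") (auto simp: integer_partition_def sorted_wrt_iff_nth_less)
  note mono = this
  show ?thesis
    unfolding diagram_def
  proof (intro conjI allI impI)
    fix i j i' j' assume "(i, j) \<in> young_diagram \<mu>" "i' \<le> i" "j' \<le> j"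
    then show "(i', j') \<in> young_diagram \<mu>"
      using mono[of i' i] by (simp add: young_diagram_def)
  qed (rule finite_young_diagram)
qed

text \<open>Positivity of the parts matters here: the length of the list is the length of the first column.\<close>
lemma inj_on_young_diagram: "inj_on young_diagram {\<mu>. integer_partition \<mu>}"
proof (rule inj_onI, clarsimp)
  fix \<mu> \<nu> assume ip: "integer_partition \<mu>" "integer_partition \<nu>"
    and eq: "young_diagram \<mu> = young_diagram \<nu>"
  have col: "{i. (i, 0) \<in> young_diagram \<kappa>} = {..<length \<kappa>}" if "integer_partition \<kappa>" for \<kappa>
  proof -
    have "0 < \<kappa> ! i" if "i < length \<kappa>" for i
      using nth_mem[OF that] \<open>integer_partition \<kappa>\<close> by (metis gr0I integer_partition_def)
    then show ?thesis by (auto simp: young_diagram_def)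
  qed
  have rows: "{j. (i, j) \<in> young_diagram \<kappa>} = {..<\<kappa> ! i}" if "i < length \<kappa>" for i and \<kappa> :: "nat list"
    using that by (auto simp: young_diagram_def)
  have len: "length \<mu> = length \<nu>"
    using col[OF ip(1)] col[OF ip(2)] eq by (metis lessThan_eq_iff)
  moreover have "\<mu> ! i = \<nu> ! i" if "i < length \<mu>" for i
    using rows[of i \<mu>] rows[of i \<nu>] that len eq by (metis lessThan_eq_iff)
  ultimately show "\<mu> = \<nu>" by (rule nth_equalityI)
qed

lemma diagram_is_young_diagram:
  assumes S: "diagram S"
  shows "\<exists>\<mu>. integer_partition \<mu> \<and> young_diagram \<mu> = S"
proof -
  define n where "n = card {i. (i, 0) \<in> S}"
  have "finite {i. (i, 0::nat) \<in> S}"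
    by (rule finite_subset[of _ "fst ` S"]) (force simp: S diagram_finite)+
  from finite_downset_nat[OF this] diagramD[OF S]
  have col: "(i, 0) \<in> S \<longleftrightarrow> i < n" for i
    unfolding n_def by (metis (no_types, lifting) lessThan_iff mem_Collect_eq order_refl)
  let ?\<mu> = "map (row S) [0..<n]"
  have "integer_partition ?\<mu>"
    unfolding integer_partition_def
  proof
    show "sorted_wrt (\<ge>) ?\<mu>"
      by (simp add: sorted_wrt_iff_nth_less row_antimono[OF S])
    have "0 < row S i" if "i < n" for i
      using that col[of i] mem_diagram_iff[OF S, of i 0] by simp
    then show "0 \<notin> set ?\<mu>" by force
  qed
  moreover have "young_diagram ?\<mu> = S"
  proof -
    have "(i, j) \<in> young_diagram ?\<mu> \<longleftrightarrow> (i, j) \<in> S" for i j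
      using col[of i] mem_diagram_iff[OF S, of i j] diagramD[OF S, of i j i 0]
      by (auto simp: young_diagram_def)
    then show ?thesis by auto
  qed
  ultimately show ?thesis by blast
qed

section \<open>Local structure of Young's lattice\<close>

text \<open>The empty step is included, so that summation over \<open>down\<close> is the operator \<open>1 + D\<close> and
  summation over \<open>up\<close> is \<open>1 + U\<close>.\<close>
definition down :: "(nat \<times> nat) set \<Rightarrow> (nat \<times> nat) set set" where
  "down S = {T. diagram T \<and> T \<subseteq> S \<and> card (S - T) \<le> 1}"

definition up :: "(nat \<times> nat) set \<Rightarrow> (nat \<times> nat) set set" where
  "up S = {T. diagram T \<and> S \<subseteq> T \<and> card (T - S) \<le> 1}"

lemma subset_card_Diff_le_1_iff:
  assumes "finite T"
  shows "S \<subseteq> T \<and> card (T - S) \<le> 1 \<longleftrightarrow> T = S \<or> (\<exists>x. x \<notin> S \<and> T = insert x S)"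
proof
  assume *: "S \<subseteq> T \<and> card (T - S) \<le> 1"
  then have "T - S = {} \<or> (\<exists>x. T - S = {x})"
    using assms by (metis card_0_eq card_1_singletonE finite_Diff le_neq_implies_less less_one)
  with * show "T = S \<or> (\<exists>x. x \<notin> S \<and> T = insert x S)" by blast
next
  assume "T = S \<or> (\<exists>x. x \<notin> S \<and> T = insert x S)"
  then show "S \<subseteq> T \<and> card (T - S) \<le> 1"
    by (auto simp: insert_Diff_if)
qed

lemma up_iff:
  "T \<in> up S \<longleftrightarrow> diagram T \<and> (T = S \<or> (\<exists>x. x \<notin> S \<and> T = insert x S))"
  using subset_card_Diff_le_1_iff[of T S] diagram_finite[of T]
  by (cases "diagram T") (simp_all add: up_def)

lemma down_iff:
  assumes "diagram S"
  shows "T \<in> down S \<longleftrightarrow> diagram T \<and> (S = T \<or> (\<exists>x. x \<notin> T \<and> S = insert x T))"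
  using subset_card_Diff_le_1_iff[OF diagram_finite[OF assms], of T] by (simp add: down_def)

lemma down_empty: "down {} = {{}}"
  by (auto simp: down_def diagram_def)

text \<open>A cell can be added at the end of row \<open>i\<close> iff \<open>i = 0\<close> or row \<open>i\<close> is shorter than the row
  above it. Writing \<open>i = Suc i'\<close> in the second case indexes these rows by the rows \<open>i'\<close> that
  can lose a cell in \<open>down_eq\<close>, up to the extra row 0.\<close>
lemma up_eq:
  assumes S: "diagram S"
  shows "up S = insert S ((\<lambda>i. insert (i, row S i) S) ` insert 0 (Suc ` {i. row S (Suc i) < row S i}))"
    (is "_ = insert S (?f ` ?A)")
proof (intro equalityI subsetI)
  fix T assume "T \<in> up S"
  then consider "T = S" | i j where "(i, j) \<notin> S" "T = insert (i, j) S" "diagram T"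
    by (auto simp: up_iff)
  then show "T \<in> insert S (?f ` ?A)"
  proof cases
    case 2
    have "(i, row S i) \<in> T"
      using diagramD[OF \<open>diagram T\<close>, of i j i "row S i"] 2 mem_diagram_iff[OF S] by auto
    then have j: "j = row S i" using 2(2) mem_diagram_iff[OF S] by auto
    have "i \<in> ?A"
    proof (cases i)
      case (Suc i')
      then have "(i', j) \<in> S"
        using diagramD[OF \<open>diagram T\<close>, of i j i' j] 2(2) by auto
      then show ?thesis using Suc j mem_diagram_iff[OF S] by auto
    qed simp
    then show ?thesis using 2 j by blast
  qed simp
next
  fix T assume "T \<in> insert S (?f ` ?A)"
  then consider "T = S" | i where "i \<in> ?A" "T = ?f i" by blast
  then show "T \<in> up S"
  proof cases
    case 2
    have less: "row S i < row S i'" if lt: "i' < i" for i'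
    proof -
      obtain m where m: "i = Suc m" "row S (Suc m) < row S m" using 2(1) lt by auto
      then show ?thesis using lt row_antimono[OF S, of i' m] by simp
    qed
    have "diagram T"
      unfolding diagram_def
    proof (intro conjI allI impI)
      show "finite T" using 2 diagram_finite[OF S] by simp
      fix a b a' b' assume "(a, b) \<in> T" "a' \<le> a" "b' \<le> b"
      then show "(a', b') \<in> T"
        using 2(2) less[of a'] diagramD[OF S, of a b a' b'] mem_diagram_iff[OF S, of a' b']
        by (cases "a' = a") auto
    qed
    then show ?thesis using 2 mem_diagram_iff[OF S] by (auto simp: up_iff)
  qed (simp add: up_iff S)
qed

lemma down_eq:
  assumes S: "diagram S"
  shows "down S = insert S ((\<lambda>i. S - {(i, row S i - 1)}) ` {i. row S (Suc i) < row S i})"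
    (is "_ = insert S (?f ` ?R)")
proof (intro equalityI subsetI)
  fix T assume "T \<in> down S"
  then consider "T = S" | i j where "(i, j) \<notin> T" "S = insert (i, j) T" "diagram T"
    by (auto simp: down_iff[OF S])
  then show "T \<in> insert S (?f ` ?R)"
  proof cases
    case 2
    have ij: "j < row S i" using mem_diagram_iff[OF S] 2 by auto
    have "(i, Suc j) \<notin> S"
      using diagramD[OF \<open>diagram T\<close>, of i "Suc j" i j] 2 by auto
    then have j: "j = row S i - 1" using mem_diagram_iff[OF S] ij by auto
    have "(Suc i, j) \<notin> S"
      using diagramD[OF \<open>diagram T\<close>, of "Suc i" j i j] 2 by auto
    then have "i \<in> ?R" using mem_diagram_iff[OF S] ij by auto
    moreover have "T = S - {(i, j)}" using 2(1,2) by simp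
    then have "T = ?f i" unfolding j .
    ultimately show ?thesis by blast
  qed simp
next
  fix T assume "T \<in> insert S (?f ` ?R)"
  then consider "T = S" | i where "i \<in> ?R" "T = ?f i" by blast
  then show "T \<in> down S"
  proof cases
    case 2
    have less: "row S i' < row S i" if "i < i'" for i'
      using 2(1) that row_antimono[OF S, of "Suc i" i'] by auto
    have "diagram T"
      unfolding diagram_def
    proof (intro conjI allI impI)
      show "finite T" using 2 diagram_finite[OF S] by simp
      fix a b a' b' assume *: "(a, b) \<in> T" "a' \<le> a" "b' \<le> b"
      then have "(a, b) \<in> S" using 2 by auto
      then have "(a', b') \<in> S" using * diagramD[OF S] by blast
      moreover have "(a', b') \<noteq> (i, row S i - 1)"
        using * 2(2) less[of a] mem_diagram_iff[OF S, of a b] by (cases "a = i") auto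
      ultimately show "(a', b') \<in> T" using 2(2) by blast
    qed
    moreover have "(i, row S i - 1) \<in> S"
      using 2(1) mem_diagram_iff[OF S] by auto
    ultimately show ?thesis using 2 by (auto simp: down_iff[OF S])
  qed (simp add: down_iff S)
qed

lemma finite_corner_rows:
  assumes S: "diagram S"
  shows "finite {i. row S (Suc i) < row S i}"
proof (rule finite_subset)
  show "{i. row S (Suc i) < row S i} \<subseteq> fst ` S"
    using mem_diagram_iff[OF S] by force
qed (simp add: diagram_finite S)

lemma finite_up: "diagram S \<Longrightarrow> finite (up S)"
  by (simp add: up_eq finite_corner_rows)

lemma finite_down: "diagram S \<Longrightarrow> finite (down S)"
  by (simp add: down_eq finite_corner_rows)

text \<open>The relation \<open>s U = s (D + 1)\<close>: row \<open>i\<close> can lose a cell iff row \<open>i + 1\<close> can gain one, and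
  row 0 can always gain one.\<close>
lemma card_up_eq_Suc_card_down:
  assumes S: "diagram S"
  shows "card (up S) = Suc (card (down S))"
proof -
  let ?R = "{i. row S (Suc i) < row S i}"
  let ?A = "insert 0 (Suc ` ?R)"
  have notin: "(i, row S i) \<notin> S" for i using mem_diagram_iff[OF S] by auto
  have corner: "(i, row S i - 1) \<in> S" if "i \<in> ?R" for i using that mem_diagram_iff[OF S] by auto
  have "card (up S) = Suc (card ((\<lambda>i. insert (i, row S i) S) ` ?A))"
    unfolding up_eq[OF S] using notin
    by (subst card_insert_disjoint) (auto simp: finite_corner_rows[OF S] dest: equalityD2)
  also have "card ((\<lambda>i. insert (i, row S i) S) ` ?A) = card ?A"
    using notin by (intro card_image inj_onI) blast
  also have "\<dots> = Suc (card ?R)"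
    by (subst card_insert_disjoint) (auto simp: finite_corner_rows[OF S] card_image)
  also have "card ?R = card ((\<lambda>i. S - {(i, row S i - 1)}) ` ?R)"
    using corner by (intro card_image[symmetric] inj_onI) blast
  also have "Suc \<dots> = card (down S)"
    unfolding down_eq[OF S] using corner
    by (subst card_insert_disjoint) (auto simp: finite_corner_rows[OF S])
  finally show ?thesis by simp
qed

lemma singletons_eq_or_disjoint:
  assumes "finite A" "finite B" "card A \<le> 1" "card B \<le> 1"
  shows "A = B \<or> A \<inter> B = {}"
proof -
  have "x = y" if "x \<in> A" "y \<in> A" for x y
    using that assms by (metis One_nat_def card_le_Suc0_iff_eq)
  moreover have "x = y" if "x \<in> B" "y \<in> B" for x y
    using that assms by (metis One_nat_def card_le_Suc0_iff_eq)
  ultimately show ?thesis by blast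
qed

text \<open>The relation \<open>D U - U D = 1\<close>. Paths that return to \<open>S\<close> account for the term \<open>f S\<close>, since \<open>S\<close>
  has one more upper than lower neighbour. Paths to some \<open>Z \<noteq> S\<close> going up and then down correspond
  to those going down and then up: the upper midpoint must be the join \<open>S \<union> Z\<close> and the lower
  midpoint the meet \<open>S \<inter> Z\<close>.\<close>
lemma sum_up_down_commute:
  fixes f :: "(nat \<times> nat) set \<Rightarrow> nat"
  assumes S: "diagram S"
  shows "(\<Sum>T\<in>up S. \<Sum>Z\<in>down T. f Z) = (\<Sum>T\<in>down S. \<Sum>Z\<in>up T. f Z) + f S"
proof -
  have du: "diagram T" if "T \<in> up S" for T using that by (simp add: up_iff)
  have dd: "diagram T" if "T \<in> down S" for T using that by (simp add: down_def)
  have "(\<Sum>T\<in>up S. \<Sum>Z\<in>down T. f Z) = (\<Sum>T\<in>up S. f S + (\<Sum>Z\<in>down T - {S}. f Z))"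
  proof (rule sum.cong[OF refl])
    fix T assume T: "T \<in> up S"
    then have "S \<in> down T" using S by (auto simp: up_def down_def)
    then show "(\<Sum>Z\<in>down T. f Z) = f S + (\<Sum>Z\<in>down T - {S}. f Z)"
      by (intro sum.remove finite_down du T)
  qed
  also have "\<dots> = card (up S) * f S + (\<Sum>T\<in>up S. \<Sum>Z\<in>down T - {S}. f Z)"
    by (simp add: sum.distrib)
  also have "(\<Sum>T\<in>up S. \<Sum>Z\<in>down T - {S}. f Z)
      = (\<Sum>(T, Z)\<in>(SIGMA T:up S. down T - {S}). f Z)"
    by (intro sum.Sigma) (auto simp: finite_up S finite_down du)
  also have "\<dots> = (\<Sum>(T, Z)\<in>(SIGMA T:down S. up T - {S}). f Z)"
  proof (rule sum.reindex_bij_witness[where i = "\<lambda>(T, Z). (S \<union> Z, Z)" and j = "\<lambda>(T, Z). (S \<inter> Z, Z)"])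
    \<comment> \<open>\<open>S\<close> and \<open>Z\<close> each lack at most one cell of \<open>T\<close>, and not the same one, as
      \<open>Z \<noteq> S\<close>; hence together they cover \<open>T\<close>, and a cell of \<open>S\<close> outside \<open>Z\<close> is the one
      that \<open>Z\<close> lacks.\<close>
    have meet: "S \<union> Z = T \<and> S \<inter> Z \<in> down S \<and> Z \<in> up (S \<inter> Z)"
      if T: "T \<in> up S" and Z: "Z \<in> down T" and "Z \<noteq> S" for T Z
    proof -
      have "finite (T - S)" "finite (T - Z)" using du[OF T] diagram_finite by auto
      moreover have le: "S \<subseteq> T" "Z \<subseteq> T" "card (T - S) \<le> 1" "card (T - Z) \<le> 1"
        using T Z by (auto simp: up_def down_def)
      moreover have "T - S \<noteq> T - Z" using le \<open>Z \<noteq> S\<close> by blast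
      ultimately have "(T - S) \<inter> (T - Z) = {}" "card (S - Z) \<le> 1" "card (Z - S) \<le> 1"
        using singletons_eq_or_disjoint[of "T - S" "T - Z"]
          card_mono[of "T - S" "Z - S"] card_mono[of "T - Z" "S - Z"] by force+
      moreover have "diagram Z" "diagram (S \<inter> Z)"
        using Z S by (auto simp: down_def intro: diagram_Int)
      moreover have "S - S \<inter> Z = S - Z" "Z - S \<inter> Z = Z - S" by blast+
      ultimately show ?thesis using le unfolding up_def down_def by auto
    qed
    have join: "S \<inter> Z = T \<and> S \<union> Z \<in> up S \<and> Z \<in> down (S \<union> Z)"
      if T: "T \<in> down S" and Z: "Z \<in> up T" and "Z \<noteq> S" for T Z
    proof -
      have dZ: "diagram Z" using Z by (simp add: up_def)
      have "finite (S - T)" "finite (Z - T)" using S dZ diagram_finite by auto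
      moreover have le: "T \<subseteq> S" "T \<subseteq> Z" "card (S - T) \<le> 1" "card (Z - T) \<le> 1"
        using T Z by (auto simp: up_def down_def)
      moreover have "S - T \<noteq> Z - T" using le \<open>Z \<noteq> S\<close> by blast
      ultimately have "(S - T) \<inter> (Z - T) = {}" "card (S - Z) \<le> 1" "card (Z - S) \<le> 1"
        using singletons_eq_or_disjoint[of "S - T" "Z - T"]
          card_mono[of "S - T" "S - Z"] card_mono[of "Z - T" "Z - S"] by force+
      moreover have "diagram (S \<union> Z)" using dZ S by (rule diagram_Un[rotated])
      moreover have "S \<union> Z - S = Z - S" "S \<union> Z - Z = S - Z" by blast+
      ultimately show ?thesis using le dZ unfolding up_def down_def by auto
    qed
    fix p
    show "(case case p of (T, Z) \<Rightarrow> (S \<inter> Z, Z) of (T, Z) \<Rightarrow> (S \<union> Z, Z)) = p"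
      and "(case p of (T, Z) \<Rightarrow> (S \<inter> Z, Z)) \<in> (SIGMA T:down S. up T - {S})"
      and "(case case p of (T, Z) \<Rightarrow> (S \<inter> Z, Z) of (T, Z) \<Rightarrow> f Z) = (case p of (T, Z) \<Rightarrow> f Z)"
      if "p \<in> (SIGMA T:up S. down T - {S})"
      using that meet by auto
    show "(case case p of (T, Z) \<Rightarrow> (S \<union> Z, Z) of (T, Z) \<Rightarrow> (S \<inter> Z, Z)) = p"
      and "(case p of (T, Z) \<Rightarrow> (S \<union> Z, Z)) \<in> (SIGMA T:up S. down T - {S})"
      if "p \<in> (SIGMA T:down S. up T - {S})"
      using that join by auto
  qed
  also have "(\<Sum>(T, Z)\<in>(SIGMA T:down S. up T - {S}). f Z) = (\<Sum>T\<in>down S. \<Sum>Z\<in>up T - {S}. f Z)"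
    by (intro sum.Sigma[symmetric]) (auto simp: finite_up S finite_down dd)
  also have "card (up S) * f S + \<dots> = (\<Sum>T\<in>down S. f S + (\<Sum>Z\<in>up T - {S}. f Z)) + f S"
    by (simp add: sum.distrib card_up_eq_Suc_card_down[OF S])
  also have "(\<Sum>T\<in>down S. f S + (\<Sum>Z\<in>up T - {S}. f Z)) = (\<Sum>T\<in>down S. \<Sum>Z\<in>up T. f Z)"
  proof (rule sum.cong[OF refl])
    fix T assume T: "T \<in> down S"
    then have "S \<in> up T" using S by (auto simp: up_def down_def)
    then show "f S + (\<Sum>Z\<in>up T - {S}. f Z) = (\<Sum>Z\<in>up T. f Z)"
      by (intro sum.remove[symmetric] finite_up dd T)
  qed
  finally show ?thesis .
qed

text \<open>The functional \<open>s (1 + D)^t\<close>, evaluated at \<open>S\<close>.\<close>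
fun removal_chains :: "nat \<Rightarrow> (nat \<times> nat) set \<Rightarrow> nat" where
  "removal_chains 0 S = 1"
| "removal_chains (Suc t) S = (\<Sum>T\<in>down S. removal_chains t T)"

lemma removal_chains_empty: "removal_chains t {} = 1"
  by (induction t) (simp_all add: down_empty)

lemma sum_down_removal_chains:
  "(\<Sum>T\<in>down S. removal_chains t T + removal_chains (Suc t) T + t * removal_chains (t - 1) T)
    = removal_chains (Suc t) S + removal_chains (Suc (Suc t)) S + t * removal_chains t S"
proof -
  have "t * removal_chains t S = (\<Sum>T\<in>down S. t * removal_chains (t - 1) T)"
    by (cases t) (simp_all add: sum_distrib_left)
  then show ?thesis by (simp add: sum.distrib)
qed

text \<open>Moving \<open>1 + U\<close> to the left past \<open>t\<close> factors \<open>1 + D\<close> costs one term \<open>(1 + D)^(t - 1)\<close> per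
  factor, which gives the coefficient \<open>t\<close>; at the far left, \<open>s (1 + U) = s + s (1 + D)\<close>. For
  \<open>t = 0\<close> the truncated \<open>t - 1\<close> is multiplied by 0.\<close>
lemma sum_up_removal_chains:
  assumes "diagram S"
  shows "(\<Sum>T\<in>up S. removal_chains t T)
    = removal_chains t S + removal_chains (Suc t) S + t * removal_chains (t - 1) S"
  using assms
proof (induction t arbitrary: S)
  case 0
  then show ?case by (simp add: card_up_eq_Suc_card_down)
next
  case (Suc t)
  have "(\<Sum>T\<in>up S. removal_chains (Suc t) T)
      = (\<Sum>T\<in>down S. \<Sum>Z\<in>up T. removal_chains t Z) + removal_chains t S"
    by (simp add: sum_up_down_commute Suc.prems)
  also have "(\<Sum>T\<in>down S. \<Sum>Z\<in>up T. removal_chains t Z)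
      = (\<Sum>T\<in>down S. removal_chains t T + removal_chains (Suc t) T + t * removal_chains (t - 1) T)"
    by (intro sum.cong[OF refl] Suc.IH) (simp add: down_def)
  also note sum_down_removal_chains
  finally show ?case by simp
qed

lemma sum_down_up_removal_chains:
  assumes "diagram S"
  shows "(\<Sum>T\<in>down S. \<Sum>Z\<in>up T. removal_chains t Z)
    = t * removal_chains t S + removal_chains (Suc t) S + removal_chains (Suc (Suc t)) S"
proof -
  have "(\<Sum>T\<in>down S. \<Sum>Z\<in>up T. removal_chains t Z)
      = (\<Sum>T\<in>down S. removal_chains t T + removal_chains (Suc t) T + t * removal_chains (t - 1) T)"
    by (intro sum.cong[OF refl] sum_up_removal_chains) (simp add: down_def)
  also note sum_down_removal_chains
  finally show ?thesis by simp
qed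

section \<open>Tableaux with an arbitrary starting shape\<close>

text \<open>The final shape is left open as well as the initial one, so that these sets comprise the
  tableaux of all shapes at once.\<close>
definition tableaux_from :: "nat \<Rightarrow> nat list \<Rightarrow> nat list list set" where
  "tableaux_from k \<kappa> =
     {t. length t = 2 * k + 2 \<and>
         (\<forall>\<nu>\<in>set t. integer_partition \<nu>) \<and> t ! 0 = \<kappa> \<and>
         (\<forall>j\<le>k. removes_at_most_one (t ! (2 * j)) (t ! (2 * j + 1))) \<and>
         (\<forall>j<k. removes_at_most_one (t ! (2 * j + 2)) (t ! (2 * j + 1)))}"

definition below :: "nat list \<Rightarrow> nat list set" where
  "below \<kappa> = {\<mu>. integer_partition \<mu> \<and> removes_at_most_one \<kappa> \<mu>}"

definition above :: "nat list \<Rightarrow> nat list set" where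
  "above \<mu> = {\<kappa>. integer_partition \<kappa> \<and> removes_at_most_one \<kappa> \<mu>}"

lemma removes_at_most_one_iff:
  "removes_at_most_one \<kappa> \<mu> \<longleftrightarrow>
     young_diagram \<mu> \<subseteq> young_diagram \<kappa> \<and> card (young_diagram \<kappa> - young_diagram \<mu>) \<le> 1"
  unfolding removes_at_most_one_def by auto

lemma bij_betw_below: "bij_betw young_diagram (below \<kappa>) (down (young_diagram \<kappa>))"
proof (rule bij_betw_imageI)
  show "inj_on young_diagram (below \<kappa>)"
    by (rule inj_on_subset[OF inj_on_young_diagram]) (auto simp: below_def)
  show "young_diagram ` below \<kappa> = down (young_diagram \<kappa>)"
  proof (intro equalityI subsetI)
    fix S assume "S \<in> young_diagram ` below \<kappa>"
    then show "S \<in> down (young_diagram \<kappa>)"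
      by (auto simp: below_def down_def removes_at_most_one_iff intro: diagram_young_diagram)
  next
    fix S assume S: "S \<in> down (young_diagram \<kappa>)"
    then obtain \<nu> where "integer_partition \<nu>" "young_diagram \<nu> = S"
      using diagram_is_young_diagram by (auto simp: down_def)
    with S have "\<nu> \<in> below \<kappa>"
      by (simp add: below_def down_def removes_at_most_one_iff)
    then show "S \<in> young_diagram ` below \<kappa>"
      using \<open>young_diagram \<nu> = S\<close> by blast
  qed
qed

lemma bij_betw_above: "bij_betw young_diagram (above \<mu>) (up (young_diagram \<mu>))"
proof (rule bij_betw_imageI)
  show "inj_on young_diagram (above \<mu>)"
    by (rule inj_on_subset[OF inj_on_young_diagram]) (auto simp: above_def)
  show "young_diagram ` above \<mu> = up (young_diagram \<mu>)"
  proof (intro equalityI subsetI)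
    fix S assume "S \<in> young_diagram ` above \<mu>"
    then show "S \<in> up (young_diagram \<mu>)"
      by (auto simp: above_def up_def removes_at_most_one_iff intro: diagram_young_diagram)
  next
    fix S assume S: "S \<in> up (young_diagram \<mu>)"
    then obtain \<nu> where "integer_partition \<nu>" "young_diagram \<nu> = S"
      using diagram_is_young_diagram by (auto simp: up_def)
    with S have "\<nu> \<in> above \<mu>"
      by (simp add: above_def up_def removes_at_most_one_iff)
    then show "S \<in> young_diagram ` above \<mu>"
      using \<open>young_diagram \<nu> = S\<close> by blast
  qed
qed

lemma finite_below: "integer_partition \<kappa> \<Longrightarrow> finite (below \<kappa>)"
  using bij_betw_finite[OF bij_betw_below] finite_down[OF diagram_young_diagram] by blast

lemma finite_above: "integer_partition \<mu> \<Longrightarrow> finite (above \<mu>)"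
  using bij_betw_finite[OF bij_betw_above] finite_up[OF diagram_young_diagram] by blast

lemma tableaux_from_0:
  assumes "integer_partition \<kappa>"
  shows "tableaux_from 0 \<kappa> = (\<lambda>\<mu>. [\<kappa>, \<mu>]) ` below \<kappa>"
  using assms
  by (auto simp: tableaux_from_def below_def length_Suc_conv numeral_2_eq_2)

text \<open>Cutting off the first removal and the first addition leaves a shorter tableau, which starts at
  the partition reached.\<close>
lemma tableaux_from_Suc:
  assumes "integer_partition \<kappa>"
  shows "tableaux_from (Suc k) \<kappa>
    = (\<lambda>(\<mu>, \<nu>, t). \<kappa> # \<mu> # t) ` (SIGMA \<mu>:below \<kappa>. SIGMA \<nu>:above \<mu>. tableaux_from k \<nu>)"
    (is "_ = ?R")
proof -
  have le: "(\<forall>j\<le>Suc k. P j) \<longleftrightarrow> P 0 \<and> (\<forall>j\<le>k. P (Suc j))" for P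
    by (metis Suc_le_mono le0 not0_implies_Suc)
  have mem: "\<kappa>' # \<mu> # t \<in> tableaux_from (Suc k) \<kappa> \<longleftrightarrow>
      \<kappa>' = \<kappa> \<and> \<mu> \<in> below \<kappa> \<and> t ! 0 \<in> above \<mu> \<and> t \<in> tableaux_from k (t ! 0)" for \<kappa>' \<mu> t
  proof -
    have "t ! 0 \<in> set t" if "length t = 2 * k + 2" using that by (intro nth_mem) simp
    then show ?thesis
      using assms unfolding tableaux_from_def above_def below_def mem_Collect_eq le All_less_Suc2
      by auto
  qed
  show ?thesis
  proof (intro equalityI subsetI)
    fix u assume u: "u \<in> tableaux_from (Suc k) \<kappa>"
    then have "length u = Suc (Suc (2 * k + 2))" by (simp add: tableaux_from_def)
    then obtain \<kappa>' \<mu> t where "u = \<kappa>' # \<mu> # t" by (auto simp: length_Suc_conv)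
    with u mem[of \<kappa>' \<mu> t] show "u \<in> ?R" by force
  next
    fix u assume "u \<in> ?R"
    then obtain \<mu> \<nu> t where "u = \<kappa> # \<mu> # t" "\<mu> \<in> below \<kappa>" "\<nu> \<in> above \<mu>" "t \<in> tableaux_from k \<nu>"
      by auto
    moreover from this have "t ! 0 = \<nu>" by (simp add: tableaux_from_def)
    ultimately show "u \<in> tableaux_from (Suc k) \<kappa>" using mem by simp
  qed
qed

lemma finite_tableaux_from: "integer_partition \<kappa> \<Longrightarrow> finite (tableaux_from k \<kappa>)"
proof (induction k arbitrary: \<kappa>)
  case 0
  then show ?case by (simp add: tableaux_from_0 finite_below)
next
  case (Suc k)
  then show ?case
    unfolding tableaux_from_Suc[OF Suc.prems]
    by (intro finite_imageI finite_SigmaI finite_below finite_above Suc.IH)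
       (simp_all add: below_def above_def)
qed

lemma card_tableaux_from_Suc:
  assumes "integer_partition \<kappa>"
  shows "card (tableaux_from (Suc k) \<kappa>) = (\<Sum>\<mu>\<in>below \<kappa>. \<Sum>\<nu>\<in>above \<mu>. card (tableaux_from k \<nu>))"
proof -
  have 1: "\<forall>\<nu>\<in>above \<mu>. finite (tableaux_from k \<nu>)" for \<mu>
    by (simp add: above_def finite_tableaux_from)
  have 2: "\<forall>\<mu>\<in>below \<kappa>. finite (above \<mu>)"
    by (simp add: below_def finite_above)
  have "card (tableaux_from (Suc k) \<kappa>)
      = card (SIGMA \<mu>:below \<kappa>. SIGMA \<nu>:above \<mu>. tableaux_from k \<nu>)"
    unfolding tableaux_from_Suc[OF assms]
    by (intro card_image inj_onI) (auto simp: tableaux_from_def)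
  also have "\<dots> = (\<Sum>\<mu>\<in>below \<kappa>. card (SIGMA \<nu>:above \<mu>. tableaux_from k \<nu>))"
    using 1 2 by (intro card_SigmaI finite_below assms) (simp add: finite_SigmaI)
  also have "\<dots> = (\<Sum>\<mu>\<in>below \<kappa>. \<Sum>\<nu>\<in>above \<mu>. card (tableaux_from k \<nu>))"
    using 1 2 by (intro sum.cong[OF refl] card_SigmaI) auto
  finally show ?thesis .
qed

section \<open>Symmetric set partitions\<close>

definition symmetric_partitions_on :: "int set \<Rightarrow> int set set set" where
  "symmetric_partitions_on X = {P. partition_on X P \<and> (\<forall>B\<in>P. uminus ` B \<in> P)}"

lemma symmetric_partitions_on_iff:
  "P \<in> symmetric_partitions_on X \<longleftrightarrow>
     \<Union>P = X \<and> (\<forall>C\<in>P. \<forall>D\<in>P. \<forall>z. z \<in> C \<longrightarrow> z \<in> D \<longrightarrow> C = D) \<and> {} \<notin> P \<and> (\<forall>C\<in>P. uminus ` C \<in> P)"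
  unfolding symmetric_partitions_on_def partition_on_def disjoint_def by blast

lemma symmetric_partitions_onD:
  assumes "P \<in> symmetric_partitions_on X"
  shows "\<Union>P = X" and "\<And>C D z. C \<in> P \<Longrightarrow> D \<in> P \<Longrightarrow> z \<in> C \<Longrightarrow> z \<in> D \<Longrightarrow> C = D"
    and "{} \<notin> P" and "\<And>C. C \<in> P \<Longrightarrow> uminus ` C \<in> P"
    and "\<And>C. C \<in> insert {} P \<Longrightarrow> C \<subseteq> X" and "\<And>C. C \<in> insert {} P \<Longrightarrow> uminus ` C \<in> insert {} P"
  using assms unfolding symmetric_partitions_on_iff by blast+

lemma uminus_image_eq_iff: "uminus ` C = D \<longleftrightarrow> C = uminus ` D" for C D :: "int set"
  by (auto simp: image_image)

definition restrict_blocks :: "int set \<Rightarrow> int set set \<Rightarrow> int set set" where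
  "restrict_blocks X P = (\<lambda>C. C \<inter> X) ` P - {{}}"

text \<open>The block that \<open>C\<close> becomes when \<open>a\<close> is put into \<open>B\<close> and \<open>-a\<close> into \<open>-B\<close>; a symmetric \<open>B\<close>
  receives both elements.\<close>
definition grow :: "int \<Rightarrow> int set \<Rightarrow> int set \<Rightarrow> int set" where
  "grow a B C = C \<union> (if C = B then {a} else {}) \<union> (if C = uminus ` B then {- a} else {})"

text \<open>The empty set serves as a potential block of \<open>Q\<close>: for \<open>B = {}\<close> it grows into the new block
  \<open>{a, -a}\<close>, so that joining an old block and opening a new symmetric one are a single operation.
  For any other \<open>B\<close> it stays empty and is discarded.\<close>
definition attach :: "int \<Rightarrow> int set set \<Rightarrow> int set \<Rightarrow> int set set" where
  "attach a Q B = grow a B ` insert {} Q - {{}}"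

definition split_off :: "int \<Rightarrow> int set set \<Rightarrow> int set set" where
  "split_off a Q = insert {a} (insert {- a} Q)"

context
  fixes X :: "int set" and a :: int
  assumes finX: "finite X" and symX: "uminus ` X = X" and aX: "a \<notin> X" and a0: "a \<noteq> 0"
begin

lemma minus_a_notin: "- a \<notin> X"
  using aX symX by force

lemma finite_symmetric_partition: "Q \<in> symmetric_partitions_on X \<Longrightarrow> finite Q"
  using finX by (auto simp: symmetric_partitions_on_def intro: finite_elements)

lemma split_off_in:
  assumes "Q \<in> symmetric_partitions_on X"
  shows "split_off a Q \<in> symmetric_partitions_on (insert a (insert (- a) X))"
  using assms aX minus_a_notin unfolding symmetric_partitions_on_iff split_off_def by auto

lemma restrict_split_off:
  assumes "Q \<in> symmetric_partitions_on X"
  shows "restrict_blocks X (split_off a Q) = Q"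
proof -
  have sub: "C \<inter> X = C" if "C \<in> Q" for C
    using assms that unfolding symmetric_partitions_on_iff by blast
  have "(\<lambda>C. C \<inter> X) ` Q = Q"
    by (simp add: sub cong: image_cong)
  moreover have "{a} \<inter> X = {}" "{- a} \<inter> X = {}" "{} \<notin> Q"
    using assms aX minus_a_notin by (auto simp: symmetric_partitions_on_iff)
  ultimately show ?thesis
    by (simp add: restrict_blocks_def split_off_def)
qed

lemma card_split_off:
  assumes "Q \<in> symmetric_partitions_on X"
  shows "card (split_off a Q) = Suc (Suc (card Q))"
proof -
  have "{a} \<notin> Q" "{- a} \<notin> Q"
    using assms aX minus_a_notin unfolding symmetric_partitions_on_iff by blast+
  then show ?thesis
    using a0 finite_symmetric_partition[OF assms] by (simp add: split_off_def)
qed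

lemma mem_grow:
  "z \<in> grow a B C \<longleftrightarrow> z \<in> C \<or> z = a \<and> C = B \<or> z = - a \<and> C = uminus ` B"
  by (auto simp: grow_def)

lemma grow_Int:
  assumes "C \<subseteq> X"
  shows "grow a B C \<inter> X = C"
  using assms aX minus_a_notin by (auto simp: grow_def)

lemma uminus_grow: "uminus ` grow a B C = grow a B (uminus ` C)"
  by (auto simp: grow_def image_Un uminus_image_eq_iff image_image)

lemma attach_in:
  assumes Q: "Q \<in> symmetric_partitions_on X" and B: "B \<in> insert {} Q"
  shows "attach a Q B \<in> symmetric_partitions_on (insert a (insert (- a) X))"
proof -
  note sub = symmetric_partitions_onD(5)[OF Q]
  note neg = symmetric_partitions_onD(6)[OF Q]
  have union: "\<Union> (attach a Q B) = insert a (insert (- a) X)"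
  proof -
    have "\<Union> (attach a Q B) = (\<Union>C\<in>insert {} Q. grow a B C)"
      by (auto simp: attach_def)
    also have "\<dots> = insert a (insert (- a) (\<Union>Q))"
      using B neg[OF B] by (auto simp: mem_grow)
    finally show ?thesis by (simp only: symmetric_partitions_onD(1)[OF Q])
  qed
  have disj: "C = D" if "C \<in> insert {} Q" "D \<in> insert {} Q" "z \<in> grow a B C" "z \<in> grow a B D" for C D z
  proof -
    have "z \<noteq> a" "z \<noteq> - a" if "z \<in> C \<or> z \<in> D"
      using that sub[OF \<open>C \<in> insert {} Q\<close>] sub[OF \<open>D \<in> insert {} Q\<close>] aX minus_a_notin by auto
    then have "C = D \<or> z \<in> C \<and> z \<in> D"
      using that a0 unfolding mem_grow by auto
    then show ?thesis
      using symmetric_partitions_onD(2)[OF Q, of C D z] that(1,2) by blast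
  qed
  have "uminus ` E \<in> attach a Q B" if "E \<in> attach a Q B" for E
  proof -
    obtain C where C: "C \<in> insert {} Q" "E = grow a B C" "E \<noteq> {}"
      using \<open>E \<in> attach a Q B\<close> unfolding attach_def by blast
    then have "uminus ` E = grow a B (uminus ` C)" by (simp add: uminus_grow)
    then show ?thesis
      using neg[OF C(1)] C(3) unfolding attach_def by (metis Diff_iff image_eqI image_is_empty singletonD)
  qed
  moreover have "\<forall>C\<in>attach a Q B. \<forall>D\<in>attach a Q B. \<forall>z. z \<in> C \<longrightarrow> z \<in> D \<longrightarrow> C = D"
    using disj unfolding attach_def by blast
  moreover have "{} \<notin> attach a Q B" by (simp add: attach_def)
  ultimately show ?thesis
    using union unfolding symmetric_partitions_on_iff by (intro conjI ballI) simp_all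
qed

lemma restrict_attach:
  assumes Q: "Q \<in> symmetric_partitions_on X"
  shows "restrict_blocks X (attach a Q B) = Q"
proof -
  note sub = symmetric_partitions_onD(5)[OF Q]
  have "restrict_blocks X (attach a Q B) = (\<lambda>C. grow a B C \<inter> X) ` insert {} Q - {{}}"
    unfolding restrict_blocks_def attach_def by blast
  also have "(\<lambda>C. grow a B C \<inter> X) ` insert {} Q = (\<lambda>C. C) ` insert {} Q"
    by (rule image_cong[OF refl]) (rule grow_Int[OF sub])
  finally show ?thesis
    using symmetric_partitions_onD(3)[OF Q] by simp
qed

lemma card_attach:
  assumes Q: "Q \<in> symmetric_partitions_on X"
  shows "card (attach a Q B) = (if B = {} then Suc (card Q) else card Q)"
proof -
  note sub = symmetric_partitions_onD(5)[OF Q]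
  have "inj_on (grow a B) (insert {} Q)"
    using grow_Int[OF sub] by (metis inj_onI)
  moreover have "{} \<notin> Q" by (rule symmetric_partitions_onD(3)[OF Q])
  ultimately have card: "card (grow a B ` insert {} Q) = Suc (card Q)"
    using finite_symmetric_partition[OF Q] by (simp add: card_image)
  have ne: "grow a B C \<noteq> {}" if "C \<in> Q" for C
    using that \<open>{} \<notin> Q\<close> by (auto simp: grow_def)
  show ?thesis
  proof (cases "B = {}")
    case True
    then have "{} \<notin> grow a B ` insert {} Q" using ne by (force simp: grow_def)
    then show ?thesis using card True by (simp add: attach_def)
  next
    case False
    then have "grow a B {} = {}" by (simp add: grow_def)
    then have "{} \<in> grow a B ` insert {} Q" by force
    then show ?thesis
      using card False by (simp only: attach_def card_Diff_singleton) simp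
  qed
qed

text \<open>The place of insertion can be read off as the block containing \<open>a\<close>, intersected with \<open>X\<close>.\<close>
lemma inj_on_attach:
  assumes Q: "Q \<in> symmetric_partitions_on X"
  shows "inj_on (attach a Q) (insert {} Q)"
proof (rule inj_onI)
  fix B B' assume B: "B \<in> insert {} Q" "B' \<in> insert {} Q" and eq: "attach a Q B = attach a Q B'"
  note sub = symmetric_partitions_onD(5)[OF Q]
  have "a \<in> grow a B B" by (simp add: mem_grow)
  then have "grow a B B \<in> attach a Q B"
    using B(1) unfolding attach_def by blast
  then have "grow a B B \<in> attach a Q B'" by (simp only: eq)
  then obtain D where D: "D \<in> insert {} Q" "grow a B B = grow a B' D"
    unfolding attach_def by blast
  have "a \<in> grow a B' D" using \<open>a \<in> grow a B B\<close> D by simp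
  then have "D = B'" using sub[OF D(1)] aX a0 by (auto simp: mem_grow)
  then show "B = B'" using D(2) grow_Int[OF sub] B by metis
qed

lemma uminus_Int: "uminus ` (C \<inter> X) = uminus ` C \<inter> X"
  by (simp add: image_Int symX)

lemma restrict_in:
  assumes P: "P \<in> symmetric_partitions_on (insert a (insert (- a) X))"
  shows "restrict_blocks X P \<in> symmetric_partitions_on X"
proof -
  note PD = symmetric_partitions_onD[OF P]
  have "uminus ` C \<in> restrict_blocks X P" if C: "C \<in> restrict_blocks X P" for C
  proof -
    obtain D where D: "D \<in> P" "C = D \<inter> X" "C \<noteq> {}" using C unfolding restrict_blocks_def by blast
    then have "uminus ` C = uminus ` D \<inter> X" by (simp only: uminus_Int)
    then show ?thesis using PD(4)[OF D(1)] D(3) unfolding restrict_blocks_def by blast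
  qed
  moreover have "\<Union> (restrict_blocks X P) = X"
  proof -
    have "\<Union> (restrict_blocks X P) = \<Union>P \<inter> X" unfolding restrict_blocks_def by blast
    then show ?thesis unfolding PD(1) by blast
  qed
  moreover have "C = D" if CD: "C \<in> restrict_blocks X P" "D \<in> restrict_blocks X P" "z \<in> C" "z \<in> D" for C D z
  proof -
    obtain C' D' where "C' \<in> P" "C = C' \<inter> X" "D' \<in> P" "D = D' \<inter> X"
      using CD(1,2) unfolding restrict_blocks_def by blast
    then show ?thesis using PD(2)[of C' D' z] CD(3,4) by blast
  qed
  moreover have "{} \<notin> restrict_blocks X P" by (simp add: restrict_blocks_def)
  ultimately show ?thesis
    unfolding symmetric_partitions_on_iff by blast
qed

text \<open>The block \<open>A\<close> of \<open>a\<close> decides everything: by symmetry \<open>-a\<close> lies in \<open>-A\<close>, and all other blocks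
  are already blocks over \<open>X\<close>. If \<open>A = {a}\<close>, the two new elements are split off; otherwise they were
  attached at \<open>A \<inter> X\<close>.\<close>
lemma extension_cases:
  assumes P: "P \<in> symmetric_partitions_on (insert a (insert (- a) X))"
  shows "P = split_off a (restrict_blocks X P) \<or> P \<in> attach a (restrict_blocks X P) ` insert {} (restrict_blocks X P)"
proof -
  note un = symmetric_partitions_onD(1)[OF P] and disj = symmetric_partitions_onD(2)[OF P]
    and ne = symmetric_partitions_onD(3)[OF P] and neg = symmetric_partitions_onD(4)[OF P]
  obtain A where A: "A \<in> P" "a \<in> A" using un by blast
  then have nA: "uminus ` A \<in> P" "- a \<in> uminus ` A" using neg by auto
  note nX = uminus_Int
  have other: "C \<subseteq> X" if "C \<in> P" "C \<noteq> A" "C \<noteq> uminus ` A" for C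
  proof -
    have "a \<notin> C" "- a \<notin> C"
      using disj[OF that(1) A(1) _ A(2)] disj[OF that(1) nA(1) _ nA(2)] that(2,3) by blast+
    moreover have "C \<subseteq> insert a (insert (- a) X)" using that(1) un by blast
    ultimately show ?thesis by blast
  qed
  show ?thesis
  proof (cases "A = {a}")
    case True
    have "C \<in> split_off a (restrict_blocks X P)" if "C \<in> P" for C
    proof (cases "C = A \<or> C = uminus ` A")
      case False
      then have "C \<inter> X = C" using other that by blast
      then have "C \<in> restrict_blocks X P" using that ne unfolding restrict_blocks_def by force
      then show ?thesis by (simp add: split_off_def)
    qed (use True in \<open>auto simp: split_off_def\<close>)
    moreover have "C \<in> P" if C: "C \<in> split_off a (restrict_blocks X P)" for C
    proof (cases "C = {a} \<or> C = {- a}")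
      case False
      then obtain D where D: "D \<in> P" "C = D \<inter> X" "C \<noteq> {}"
        using C unfolding split_off_def restrict_blocks_def by blast
      then have "D \<noteq> A" "D \<noteq> uminus ` A" using True aX minus_a_notin by auto
      then show ?thesis using other D by (metis inf.orderE)
    qed (use True A nA in auto)
    ultimately show ?thesis by blast
  next
    case False
    define B where "B = A \<inter> X"
    have B: "B \<in> insert {} (restrict_blocks X P)" using A by (auto simp: B_def restrict_blocks_def)
    \<comment> \<open>Whether \<open>A\<close> is a symmetric block can be seen after restriction to \<open>X\<close>: if
      \<open>A \<inter> X\<close> is symmetric and nonempty, then \<open>A\<close> meets the block \<open>-A\<close>. If it is empty,
      then \<open>A = {a, -a}\<close>, since the case \<open>A = {a}\<close> was split off.\<close>
    have A_eq: "- a \<in> A \<longleftrightarrow> B = uminus ` B"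
    proof
      assume "- a \<in> A"
      then have "A = uminus ` A" using disj[OF A(1) nA(1)] nA by blast
      then show "B = uminus ` B" unfolding B_def by (metis nX)
    next
      assume BB: "B = uminus ` B"
      show "- a \<in> A"
      proof (cases "B = {}")
        case True
        have "A \<subseteq> {a, - a}" using A(1) un True unfolding B_def by blast
        then show ?thesis using False A(2) by blast
      next
        case False
        then obtain z where "z \<in> A" "z \<in> uminus ` A" using BB unfolding B_def nX by blast
        then show ?thesis using disj[OF A(1) nA(1)] nA by blast
      qed
    qed
    have A_sub: "A \<subseteq> insert a (insert (- a) X)" using A un by blast
    have growB: "grow a B B = A"
      using A_eq A_sub A(2) by (auto simp: grow_def B_def)
    have grow: "grow a B (C \<inter> X) = C" if "C \<in> P" for C
    proof -
      consider "C = A" | "C = uminus ` A" | "C \<noteq> A" "C \<noteq> uminus ` A" by blast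
      then show ?thesis
      proof cases
        case 1
        then show ?thesis using growB by (simp add: B_def)
      next
        case 2
        then show ?thesis using growB uminus_grow[of B B] by (simp add: B_def nX)
      next
        case 3
        then have CX: "C \<inter> X = C" using other that by blast
        have "C \<noteq> {}" using that ne by blast
        then have "C \<noteq> B" "C \<noteq> uminus ` B"
          using 3 disj[OF that A(1)] disj[OF that nA(1)] unfolding B_def nX by blast+
        then show ?thesis by (simp add: CX grow_def)
      qed
    qed
    have "P = attach a (restrict_blocks X P) B"
    proof (intro equalityI subsetI)
      fix C assume C: "C \<in> P"
      have "C \<inter> X \<in> insert {} (restrict_blocks X P)" using C by (auto simp: restrict_blocks_def)
      then show "C \<in> attach a (restrict_blocks X P) B"
        using grow[OF C] C ne unfolding attach_def by (metis DiffI image_eqI singletonD)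
    next
      fix C assume "C \<in> attach a (restrict_blocks X P) B"
      then obtain D where D: "D \<in> insert {} (restrict_blocks X P)" "C = grow a B D" "C \<noteq> {}"
        unfolding attach_def by blast
      show "C \<in> P"
      proof (cases "D = {}")
        case True
        with D have "B = {}" by (auto simp: grow_def split: if_splits)
        then show ?thesis using True D growB A by simp
      next
        case False
        then obtain E where "E \<in> P" "D = E \<inter> X" using D(1) unfolding restrict_blocks_def by blast
        then show ?thesis using grow D(2) by simp
      qed
    qed
    then show ?thesis using B by blast
  qed
qed

lemma extensions_eq:
  assumes Q: "Q \<in> symmetric_partitions_on X"
  shows "{P \<in> symmetric_partitions_on (insert a (insert (- a) X)). restrict_blocks X P = Q}
    = insert (split_off a Q) (attach a Q ` insert {} Q)"
  using extension_cases split_off_in[OF Q] attach_in[OF Q] restrict_split_off[OF Q] restrict_attach[OF Q]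
  by blast

text \<open>Grouping the partitions of the larger set by their restriction to \<open>X\<close>: in each group, one
  partition has the new elements as singletons, one has them as a block \<open>{a, -a}\<close>, and each of the
  \<open>card Q\<close> remaining ones has as many blocks as \<open>Q\<close>.\<close>
lemma sum_symmetric_partitions_on_insert:
  fixes f :: "nat \<Rightarrow> nat"
  shows "(\<Sum>P\<in>symmetric_partitions_on (insert a (insert (- a) X)). f (card P))
    = (\<Sum>Q\<in>symmetric_partitions_on X. card Q * f (card Q) + f (Suc (card Q)) + f (Suc (Suc (card Q))))"
proof -
  let ?Y = "insert a (insert (- a) X)"
  have fin: "finite (symmetric_partitions_on Z)" if "finite Z" for Z
    by (rule finite_subset[of _ "Pow (Pow Z)"])
       (auto simp: that symmetric_partitions_on_iff)
  have "(\<Sum>P\<in>symmetric_partitions_on ?Y. f (card P))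
      = (\<Sum>Q\<in>symmetric_partitions_on X. \<Sum>P\<in>{P \<in> symmetric_partitions_on ?Y. restrict_blocks X P = Q}. f (card P))"
    by (rule sum.group[symmetric]) (use fin finX restrict_in in auto)
  also have "\<dots> = (\<Sum>Q\<in>symmetric_partitions_on X. card Q * f (card Q) + f (Suc (card Q)) + f (Suc (Suc (card Q))))"
  proof (rule sum.cong[OF refl])
    fix Q assume Q: "Q \<in> symmetric_partitions_on X"
    have finQ: "finite Q" by (rule finite_symmetric_partition[OF Q])
    have emp: "{} \<notin> Q" by (rule symmetric_partitions_onD(3)[OF Q])
    \<comment> \<open>Attaching creates at most one new block, splitting off creates two.\<close>
    have "card (split_off a Q) \<noteq> card (attach a Q B)" for B
      by (simp add: card_split_off[OF Q] card_attach[OF Q])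
    then have "split_off a Q \<notin> attach a Q ` insert {} Q" by (metis imageE)
    then have "(\<Sum>P\<in>{P \<in> symmetric_partitions_on ?Y. restrict_blocks X P = Q}. f (card P))
        = f (Suc (Suc (card Q))) + (\<Sum>P\<in>attach a Q ` insert {} Q. f (card P))"
      unfolding extensions_eq[OF Q] using finQ
      by (subst sum.insert) (simp_all add: card_split_off[OF Q])
    also have "(\<Sum>P\<in>attach a Q ` insert {} Q. f (card P)) = (\<Sum>B\<in>insert {} Q. f (card (attach a Q B)))"
      by (simp only: sum.reindex[OF inj_on_attach[OF Q]] o_def)
    also have "\<dots> = f (Suc (card Q)) + (\<Sum>B\<in>Q. f (card (attach a Q B)))"
      using finQ emp by (simp add: card_attach[OF Q])
    also have "(\<Sum>B\<in>Q. f (card (attach a Q B))) = (\<Sum>B\<in>Q. f (card Q))"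
      by (rule sum.cong[OF refl]) (use emp in \<open>auto simp: card_attach[OF Q]\<close>)
    finally show "(\<Sum>P\<in>{P \<in> symmetric_partitions_on ?Y. restrict_blocks X P = Q}. f (card P))
        = card Q * f (card Q) + f (Suc (card Q)) + f (Suc (Suc (card Q)))"
      by simp
  qed
  finally show ?thesis .
qed

end

lemma symmetric_partitions_eq: "symmetric_partitions k = symmetric_partitions_on {- int k..int k}"
  by (simp add: symmetric_partitions_def symmetric_partitions_on_def)

lemma symmetric_partitions_0: "symmetric_partitions 0 = {{{0}}}"
proof -
  have "partition_on {0} P \<longleftrightarrow> P = {{0}}" for P :: "int set set"
  proof
    assume P: "partition_on {0} P"
    have "x = {0}" if "x \<in> P" for x
    proof -
      have "x \<subseteq> {0}" "x \<noteq> {}" using P that unfolding partition_on_def by blast+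
      then show ?thesis by blast
    qed
    moreover have "P \<noteq> {}" using P by (auto simp: partition_on_def)
    ultimately show "P = {{0}}" by blast
  qed (simp add: partition_on_def)
  then have "symmetric_partitions 0 = {P. P = {{0}} \<and> (\<forall>B\<in>P. uminus ` B \<in> P)}"
    by (simp add: symmetric_partitions_def)
  also have "\<dots> = {{{0}}}" by (intro equalityI subsetI; simp)
  finally show ?thesis .
qed

lemma sum_symmetric_partitions_Suc:
  fixes f :: "nat \<Rightarrow> nat"
  shows "(\<Sum>P\<in>symmetric_partitions (Suc k). f (card P))
    = (\<Sum>Q\<in>symmetric_partitions k. card Q * f (card Q) + f (Suc (card Q)) + f (Suc (Suc (card Q))))"
proof -
  have "{- int (Suc k)..int (Suc k)} = insert (int (Suc k)) (insert (- int (Suc k)) {- int k..int k})"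
    by auto
  then show ?thesis
    unfolding symmetric_partitions_eq by (simp only:) (rule sum_symmetric_partitions_on_insert; auto)
qed

section \<open>The count\<close>

text \<open>Prefixing a tableau with a removal and an addition acts on the weight \<open>removal_chains t\<close> exactly
  as inserting \<open>\<plusminus>(k + 1)\<close> acts on a symmetric partition with \<open>t\<close> blocks. For \<open>k = 0\<close> the only
  partition \<open>{{0}}\<close> has one block, which matches the single removal step of the tableau.\<close>
theorem card_tableaux_from:
  assumes "integer_partition \<kappa>"
  shows "card (tableaux_from k \<kappa>)
    = (\<Sum>P\<in>symmetric_partitions k. removal_chains (card P) (young_diagram \<kappa>))"
  using assms
proof (induction k arbitrary: \<kappa>)
  case 0
  have "card (tableaux_from 0 \<kappa>) = card (below \<kappa>)"
    unfolding tableaux_from_0[OF 0] by (rule card_image) (simp add: inj_on_def)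
  then show ?case
    using bij_betw_same_card[OF bij_betw_below[of \<kappa>]] by (simp add: symmetric_partitions_0)
next
  case (Suc k)
  let ?S = "young_diagram \<kappa>"
  let ?F = "\<lambda>Z. \<Sum>P\<in>symmetric_partitions k. removal_chains (card P) Z"
  have S: "diagram ?S" by (rule diagram_young_diagram[OF Suc.prems])
  have "card (tableaux_from (Suc k) \<kappa>) = (\<Sum>\<mu>\<in>below \<kappa>. \<Sum>\<nu>\<in>above \<mu>. ?F (young_diagram \<nu>))"
    unfolding card_tableaux_from_Suc[OF Suc.prems]
    by (intro sum.cong[OF refl] Suc.IH) (simp add: above_def)
  also have "\<dots> = (\<Sum>\<mu>\<in>below \<kappa>. \<Sum>Z\<in>up (young_diagram \<mu>). ?F Z)"
    by (intro sum.cong[OF refl] sum.reindex_bij_betw[OF bij_betw_above])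
  also have "\<dots> = (\<Sum>T\<in>down ?S. \<Sum>Z\<in>up T. ?F Z)"
    by (rule sum.reindex_bij_betw[OF bij_betw_below])
  also have "\<dots> = (\<Sum>P\<in>symmetric_partitions k. \<Sum>T\<in>down ?S. \<Sum>Z\<in>up T. removal_chains (card P) Z)"
    by (simp only: sum.swap[where B = "symmetric_partitions k"])
  also have "\<dots> = (\<Sum>P\<in>symmetric_partitions (Suc k). removal_chains (card P) ?S)"
    unfolding sum_down_up_removal_chains[OF S]
    by (rule sum_symmetric_partitions_Suc[where f = "\<lambda>t. removal_chains t ?S", symmetric])
  finally show ?case .
qed

theorem theorem11:
  fixes k :: nat
  shows "((\<lambda>\<mu>. g_half k \<mu>) has_sum card (symmetric_partitions k)) {\<mu>. integer_partition \<mu>}"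
proof -
  let ?T = "tableaux_from k []"
  let ?M = "(\<lambda>t. t ! (2 * k + 1)) ` ?T"
  have nil: "integer_partition []" by (simp add: integer_partition_def)
  have fin: "finite ?T" by (rule finite_tableaux_from[OF nil])
  have fiber: "simplified_vacillating_tableaux k \<mu> = {t \<in> ?T. t ! (2 * k + 1) = \<mu>}" for \<mu>
    unfolding simplified_vacillating_tableaux_def tableaux_from_def by blast
  have "card ?T = (\<Sum>\<mu>\<in>?M. g_half k \<mu>)"
    using sum.image_gen[OF fin, of "\<lambda>_. 1::nat" "\<lambda>t. t ! (2 * k + 1)"]
    by (simp add: g_half_def fiber)
  moreover have "card ?T = card (symmetric_partitions k)"
    by (simp add: card_tableaux_from[OF nil] young_diagram_def removal_chains_empty)
  moreover have "((\<lambda>\<mu>. g_half k \<mu>) has_sum (\<Sum>\<mu>\<in>?M. g_half k \<mu>)) ?M"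
    using fin by (intro has_sum_finite finite_imageI)
  \<comment> \<open>Only the finitely many final shapes in \<open>?M\<close> contribute to the sum over all partitions.\<close>
  ultimately have "((\<lambda>\<mu>. g_half k \<mu>) has_sum card (symmetric_partitions k)) ?M" by simp
  moreover have "?M \<subseteq> {\<mu>. integer_partition \<mu>}"
    by (auto simp: tableaux_from_def)
  moreover have "g_half k \<mu> = 0" if "\<mu> \<notin> ?M" for \<mu>
  proof -
    have "{t \<in> ?T. t ! (2 * k + 1) = \<mu>} = {}" using that by blast
    then show ?thesis by (simp only: g_half_def fiber card.empty)
  qed
  ultimately show ?thesis
    by (subst has_sum_cong_neutral[where S = ?M and T = "{\<mu>. integer_partition \<mu>}" and g = "g_half k", symmetric]) auto
qed

end
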